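(* For the two-dimensional Euler equations, define two-point numerical fluxes (for all pairs of states with $\rho,p>0$) by $$f^{x}_{\rho}=\{\{\rho\}\}_{\log}\{\{v_x\}\},\quad f^x_{\rho v_x}=\frac{\{\{v_x/RT\}\}+\{\{1/RT\}\}\{\{v_x\}\}}{2\{\{1/RT\}\}}f^x_\rho+\frac{\{\{\rho\}\}}{\{\{1/RT\}\}},\quad f^x_{\rho v_y}=\frac{\{\{v_y/RT\}\}+\{\{1/RT\}\}\{\{v_y\}\}}{2\{\{1/RT\}\}}f^x_\rho,$$ $$f^x_{\rho e}=\left(\frac{1}{\gamma-1}\frac{\{\{RT\}\}_{\mathrm{geo}}^2}{\{\{RT\}\}_{\log}}-\frac{\{\{v_x\}\}^2+\{\{v_y\}\}^2}{2}\right)f^x_\rho+\{\{v_x\}\}f^x_{\rho v_x}+\{\{v_y\}\}f^x_{\rho v_y},$$ and $$f^{y}_{\rho}=\{\{\rho\}\}_{\log}\{\{v_y\}\},\quad f^y_{\rho v_x}=\frac{\{\{v_x/RT\}\}+\{\{1/RT\}\}\{\{v_x\}\}}{2\{\{1/RT\}\}}f^y_\rho,\quad f^y_{\rho v_y}=\frac{\{\{v_y/RT\}\}+\{\{1/RT\}\}\{\{v_y\}\}}{2\{\{1/RT\}\}}f^y_\rho+\frac{\{\{\rho\}\}}{\{\{1/RT\}\}},$$ $$f^y_{\rho e}=\left(\frac{1}{\gamma-1}\frac{\{\{RT\}\}_{\mathrm{geo}}^2}{\{\{RT\}\}_{\log}}-\frac{\{\{v_x\}\}^2+\{\{v_y\}\}^2}{2}\right)f^y_\rho+\{\{v_x\}\}f^y_{\rho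 v_x}+\{\{v_y\}\}f^y_{\rho v_y}.$$ These fluxes are entropy conservative.
   Context: Euler equations: $\partial_tu+\partial_xf_x(u)+\partial_yf_y(u)=0$, $u=(\rho,\rho v_x,\rho v_y,\rho e)^T$, $f_x=(\rho v_x,\rho v_x^2+p,\rho v_xv_y,(\rho e+p)v_x)^T$, $f_y=(\rho v_y,\rho v_xv_y,\rho v_y^2+p,(\rho e+p)v_y)^T$, $p=(\gamma-1)(\rho e-\frac12\rho v^2)$, $v^2=v_x^2+v_y^2$, $\gamma>1$ constant, $\rho,p>0$; $RT:=p/\rho$. With $s=\log(p/\rho^\gamma)$, the entropy is $U=-\rho s/(\gamma-1)$, the entropy variables are $w=\left(\frac{\gamma}{\gamma-1}-\frac{s}{\gamma-1}-\frac{\rho v^2}{2p},\frac{\rho v_x}{p},\frac{\rho v_y}{p},-\frac{\rho}{p}\right)^T$ and the flux potentials are $\psi_x=\rho v_x$, $\psi_y=\rho v_y$. Means of a quantity $a$ with values $a_-,a_+$ at the states $u_-,u_+$: $\{\{a\}\}=\frac{a_-+a_+}2$; for $a_\pm>0$, $\{\{a\}\}_{\log}=\frac{a_+-a_-}{\log a_+-\log a_-}$ (and $=a$ if $a_-=a_+=a$) and $\{\{a\}\}_{\mathrm{geo}}=\sqrt{a_+a_-}$. A two-point flux $f^j=(f^j_\rho,f^j_{\rho v_x},f^j_{\rho v_y},f^j_{\rho e})^T(u_-,u_+)$, $j\in\{x,y\}$, is entropy conservative if $(w_+-w_-)\cdot f^j(u_-,u_+)-(\psi_{j,+}-\psi_{j,-})=0$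 for all pairs of states. *)

theory Defs
  imports "HOL-Analysis.Analysis"
begin

(* A state is the vector of conserved variables u = (rho, rho v_x, rho v_y, rho e);
   in real^4 the literals 1, 2, 3, 4 are the four distinct indices (4 = 0). *)
type_synonym state = "real ^ 4"

definition density :: "state \<Rightarrow> real" where
  "density u = u $ 1"

definition vel_x :: "state \<Rightarrow> real" where
  "vel_x u = u $ 2 / density u"

definition vel_y :: "state \<Rightarrow> real" where
  "vel_y u = u $ 3 / density u"

definition pressure :: "real \<Rightarrow> state \<Rightarrow> real" where
  "pressure \<gamma> u = (\<gamma> - 1) * (u $ 4 - 1/2 * density u * ((vel_x u)\<^sup>2 + (vel_y u)\<^sup>2))"

definition admissible :: "real \<Rightarrow> state \<Rightarrow> bool" where
  "admissible \<gamma> u \<longleftrightarrow> density u > 0 \<and> pressure \<gamma> u > 0"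

definition RT :: "real \<Rightarrow> state \<Rightarrow> real" where
  "RT \<gamma> u = pressure \<gamma> u / density u"

definition spec_entropy :: "real \<Rightarrow> state \<Rightarrow> real" where
  "spec_entropy \<gamma> u = ln (pressure \<gamma> u / density u powr \<gamma>)"

(* The derivative of the entropy U = - rho s / (gamma - 1) with respect to u. *)
definition entropy_vars :: "real \<Rightarrow> state \<Rightarrow> real ^ 4" where
  "entropy_vars \<gamma> u = vector
    [\<gamma> / (\<gamma> - 1) - spec_entropy \<gamma> u / (\<gamma> - 1)
       - density u * ((vel_x u)\<^sup>2 + (vel_y u)\<^sup>2) / (2 * pressure \<gamma> u),
     density u * vel_x u / pressure \<gamma> u,
     density u * vel_y u / pressure \<gamma> u,
     - (density u / pressure \<gamma> u)]"

definition flux_potential_x :: "state \<Rightarrow> real" where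
  "flux_potential_x u = density u * vel_x u"

definition flux_potential_y :: "state \<Rightarrow> real" where
  "flux_potential_y u = density u * vel_y u"

definition entropy_conservative ::
    "real \<Rightarrow> (state \<Rightarrow> real) \<Rightarrow> (state \<Rightarrow> state \<Rightarrow> real ^ 4) \<Rightarrow> bool" where
  "entropy_conservative \<gamma> \<psi> f \<longleftrightarrow>
    (\<forall>um up. admissible \<gamma> um \<longrightarrow> admissible \<gamma> up \<longrightarrow>
      (entropy_vars \<gamma> up - entropy_vars \<gamma> um) \<bullet> f um up - (\<psi> up - \<psi> um) = 0)"

(* Means of a quantity a, given as a function of the state, at the states um and up. *)

definition arith_mean :: "(state \<Rightarrow> real) \<Rightarrow> state \<Rightarrow> state \<Rightarrow> real" where
  "arith_mean a um up = (a um + a up) / 2"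

definition log_mean :: "(state \<Rightarrow> real) \<Rightarrow> state \<Rightarrow> state \<Rightarrow> real" where
  "log_mean a um up =
    (if a um = a up then a um else (a up - a um) / (ln (a up) - ln (a um)))"

definition geo_mean :: "(state \<Rightarrow> real) \<Rightarrow> state \<Rightarrow> state \<Rightarrow> real" where
  "geo_mean a um up = sqrt (a up * a um)"

(* The factor multiplying the mass flux in the momentum fluxes, for a velocity component v. *)
definition momentum_factor :: "real \<Rightarrow> (state \<Rightarrow> real) \<Rightarrow> state \<Rightarrow> state \<Rightarrow> real" where
  "momentum_factor \<gamma> v um up =
    (arith_mean (\<lambda>u. v u / RT \<gamma> u) um up
       + arith_mean (\<lambda>u. 1 / RT \<gamma> u) um up * arith_mean v um up)
    / (2 * arith_mean (\<lambda>u. 1 / RT \<gamma> u) um up)"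

(* The factor multiplying the mass flux in the energy fluxes. *)
definition energy_factor :: "real \<Rightarrow> state \<Rightarrow> state \<Rightarrow> real" where
  "energy_factor \<gamma> um up =
    1 / (\<gamma> - 1) * ((geo_mean (RT \<gamma>) um up)\<^sup>2 / log_mean (RT \<gamma>) um up)
      - ((arith_mean vel_x um up)\<^sup>2 + (arith_mean vel_y um up)\<^sup>2) / 2"

definition euler_flux_x :: "real \<Rightarrow> state \<Rightarrow> state \<Rightarrow> real ^ 4" where
  "euler_flux_x \<gamma> um up =
    (let f\<rho> = log_mean density um up * arith_mean vel_x um up;
         fx = momentum_factor \<gamma> vel_x um up * f\<rho>
                + arith_mean density um up / arith_mean (\<lambda>u. 1 / RT \<gamma> u) um up;
         fy = momentum_factor \<gamma> vel_y um up * f\<rho>;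
         fe = energy_factor \<gamma> um up * f\<rho>
                + arith_mean vel_x um up * fx + arith_mean vel_y um up * fy
     in vector [f\<rho>, fx, fy, fe])"

definition euler_flux_y :: "real \<Rightarrow> state \<Rightarrow> state \<Rightarrow> real ^ 4" where
  "euler_flux_y \<gamma> um up =
    (let f\<rho> = log_mean density um up * arith_mean vel_y um up;
         fx = momentum_factor \<gamma> vel_x um up * f\<rho>;
         fy = momentum_factor \<gamma> vel_y um up * f\<rho>
                + arith_mean density um up / arith_mean (\<lambda>u. 1 / RT \<gamma> u) um up;
         fe = energy_factor \<gamma> um up * f\<rho>
                + arith_mean vel_x um up * fx + arith_mean vel_y um up * fy
     in vector [f\<rho>, fx, fy, fe])"

end

(* With b = 1/RT, the first entropy variable is a constant plus
   ln rho - ln RT / (gamma - 1) - b v^2 / 2.  The jump of ln RT cancels against the energy flux,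
   because [b] = - [RT] / {{RT}}_geo^2.  The momentum factor is chosen such that the kinetic terms
   cancel, by the discrete product rule [b v^2] = {{b v}} [v] + {{v}} [b v].  There remain
   [ln rho] times the mass flux, which is [rho] {{v}}, and the pressure contribution {{rho}} [v];
   together they are the jump of the flux potential rho v. *)
theory Submission
  imports Defs
begin

lemma log_mean_ne_zero:
  assumes "a um > 0" "a up > 0"
  shows "log_mean a um up \<noteq> 0"
  using assms by (auto simp: log_mean_def)

text \<open>Multiplied out, the definition holds for equal values too, where both sides vanish, so
  later steps need no case split. For distinct values, positivity keeps the logarithms
  distinct.\<close>

lemma log_mean_times_ln_diff:
  assumes "a um > 0" "a up > 0"
  shows "log_mean a um up * (ln (a up) - ln (a um)) = a up - a um"
  using assms by (auto simp: log_mean_def)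

lemma RT_pos: "admissible \<gamma> u \<Longrightarrow> RT \<gamma> u > 0"
  by (simp add: admissible_def RT_def)

lemma arith_mean_inverse_RT_pos:
  assumes "admissible \<gamma> um" "admissible \<gamma> up"
  shows "arith_mean (\<lambda>u. 1 / RT \<gamma> u) um up > 0"
  using assms[THEN RT_pos] by (simp add: arith_mean_def add_pos_pos)

text \<open>Take logarithms in p / rho^\<gamma> = RT * rho^(1 - \<gamma>).\<close>

lemma spec_entropy_eq:
  assumes "admissible \<gamma> u"
  shows "spec_entropy \<gamma> u = ln (RT \<gamma> u) - (\<gamma> - 1) * ln (density u)"
  using assms
  by (simp add: admissible_def spec_entropy_def RT_def ln_div ln_powr algebra_simps)

text \<open>In terms of density, velocity and \<open>RT\<close>, the jumps of the logarithms
  separate. The kinetic term is split by component so that each part can be matched with one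
  momentum flux.\<close>

lemma entropy_vars_eq:
  assumes "\<gamma> > 1" "admissible \<gamma> u"
  shows "entropy_vars \<gamma> u = vector
    [\<gamma> / (\<gamma> - 1) + ln (density u) - ln (RT \<gamma> u) / (\<gamma> - 1)
       - (vel_x u)\<^sup>2 / RT \<gamma> u / 2 - (vel_y u)\<^sup>2 / RT \<gamma> u / 2,
     vel_x u / RT \<gamma> u, vel_y u / RT \<gamma> u, - (1 / RT \<gamma> u)]"
proof -
  have "spec_entropy \<gamma> u / (\<gamma> - 1) = ln (RT \<gamma> u) / (\<gamma> - 1) - ln (density u)"
    using assms(1) by (simp add: spec_entropy_eq[OF assms(2)] field_simps)
  moreover have "density u * ((vel_x u)\<^sup>2 + (vel_y u)\<^sup>2) / (2 * pressure \<gamma> u)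
      = (vel_x u)\<^sup>2 / RT \<gamma> u / 2 + (vel_y u)\<^sup>2 / RT \<gamma> u / 2"
    by (simp add: RT_def field_simps add_divide_distrib)
  ultimately have "\<gamma> / (\<gamma> - 1) - spec_entropy \<gamma> u / (\<gamma> - 1)
       - density u * ((vel_x u)\<^sup>2 + (vel_y u)\<^sup>2) / (2 * pressure \<gamma> u)
    = \<gamma> / (\<gamma> - 1) + ln (density u) - ln (RT \<gamma> u) / (\<gamma> - 1)
       - (vel_x u)\<^sup>2 / RT \<gamma> u / 2 - (vel_y u)\<^sup>2 / RT \<gamma> u / 2"
    by linarith
  moreover have "density u * x / pressure \<gamma> u = x / RT \<gamma> u"
    and "density u / pressure \<gamma> u = 1 / RT \<gamma> u" for x
    by (simp_all add: RT_def)
  ultimately show ?thesis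
    by (simp only: entropy_vars_def)
qed

text \<open>Discrete product rule [b v] = {{b}} [v] + {{v}} [b] for b = 1/RT.\<close>

lemma weighted_velocity_jump:
  "v up / RT \<gamma> up - v um / RT \<gamma> um - (1 / RT \<gamma> up - 1 / RT \<gamma> um) * arith_mean v um up
    = arith_mean (\<lambda>u. 1 / RT \<gamma> u) um up * (v up - v um)"
proof -
  \<comment> \<open>With the reciprocals named, both sides are polynomials in \<open>a\<close>,
    \<open>b\<close> and the two values of \<open>v\<close>.\<close>
  define a where "a = 1 / RT \<gamma> um"
  define b where "b = 1 / RT \<gamma> up"
  have div: "x / RT \<gamma> um = x * a" "x / RT \<gamma> up = x * b" for x
    by (simp_all add: a_def b_def)
  show ?thesis
    unfolding arith_mean_def div by (simp add: field_simps)
qed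

text \<open>The prefactor cancels the denominator of \<open>momentum_factor\<close>, leaving half of
  [v] ({{b v}} + {{b}} {{v}}). Here [v] {{b v}} = [b v^2] - {{v}} [b v], and expanding [b v] by the
  product rule leaves [b v^2] - [b] {{v}}^2. The last term is what the subtracted squares in
  \<open>energy_factor\<close> compensate.\<close>

lemma momentum_factor_jump:
  assumes "admissible \<gamma> um" "admissible \<gamma> up"
  shows "arith_mean (\<lambda>u. 1 / RT \<gamma> u) um up * (v up - v um) * momentum_factor \<gamma> v um up
    = ((v up)\<^sup>2 / RT \<gamma> up - (v um)\<^sup>2 / RT \<gamma> um) / 2
      - (1 / RT \<gamma> up - 1 / RT \<gamma> um) * (arith_mean v um up)\<^sup>2 / 2"
proof -
  let ?B = "arith_mean (\<lambda>u. 1 / RT \<gamma> u) um up"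
  define a where "a = 1 / RT \<gamma> um"
  define b where "b = 1 / RT \<gamma> up"
  have div: "x / RT \<gamma> um = x * a" "x / RT \<gamma> up = x * b" for x
    by (simp_all add: a_def b_def)
  have "?B * (v up - v um) * momentum_factor \<gamma> v um up
      = (v up - v um) * (?B * momentum_factor \<gamma> v um up)"
    by (simp only: mult_ac)
  also have "?B * momentum_factor \<gamma> v um up
      = (arith_mean (\<lambda>u. v u / RT \<gamma> u) um up + ?B * arith_mean v um up) / 2"
    using arith_mean_inverse_RT_pos[OF assms] by (simp add: momentum_factor_def)
  also have "(v up - v um) * \<dots> = ((v up)\<^sup>2 * b - (v um)\<^sup>2 * a) / 2
      - (b - a) * (arith_mean v um up)\<^sup>2 / 2"
    unfolding arith_mean_def div by (simp add: power2_eq_square field_simps)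
  finally show ?thesis
    by (simp only: div mult_1)
qed

text \<open>The squared geometric mean is the product of the two values of \<open>RT\<close>, so it
  turns [1/RT] into -[RT]; division by the logarithmic mean then gives -[ln RT].\<close>

lemma energy_factor_jump:
  assumes "admissible \<gamma> um" "admissible \<gamma> up"
  shows "(1 / RT \<gamma> up - 1 / RT \<gamma> um) * energy_factor \<gamma> um up
    = - (ln (RT \<gamma> up) - ln (RT \<gamma> um)) / (\<gamma> - 1)
      - (1 / RT \<gamma> up - 1 / RT \<gamma> um)
          * ((arith_mean vel_x um up)\<^sup>2 + (arith_mean vel_y um up)\<^sup>2) / 2"
proof -
  note pos = assms[THEN RT_pos]
  let ?L = "log_mean (RT \<gamma>) um up"
  have "(1 / RT \<gamma> up - 1 / RT \<gamma> um) * (geo_mean (RT \<gamma>) um up)\<^sup>2 = - (RT \<gamma> up - RT \<gamma> um)"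
    using pos by (simp add: geo_mean_def field_simps)
  also have "\<dots> = - (?L * (ln (RT \<gamma> up) - ln (RT \<gamma> um)))"
    using pos by (simp add: log_mean_times_ln_diff)
  finally have "(1 / RT \<gamma> up - 1 / RT \<gamma> um) * ((geo_mean (RT \<gamma>) um up)\<^sup>2 / ?L)
      = - (ln (RT \<gamma> up) - ln (RT \<gamma> um))"
    using log_mean_ne_zero[of "RT \<gamma>", OF pos] by simp
  then have "(1 / RT \<gamma> up - 1 / RT \<gamma> um) * (1 / (\<gamma> - 1) * ((geo_mean (RT \<gamma>) um up)\<^sup>2 / ?L))
      = - (ln (RT \<gamma> up) - ln (RT \<gamma> um)) / (\<gamma> - 1)"
    by (metis mult.left_commute mult.left_neutral times_divide_eq_left)
  then show ?thesis
    by (simp only: energy_factor_def right_diff_distrib times_divide_eq_right)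
qed

lemma vector_4:
  fixes a b c d :: "'a :: zero"
  shows "(vector [a, b, c, d] :: 'a ^ 4) $ 1 = a" "(vector [a, b, c, d] :: 'a ^ 4) $ 2 = b"
    "(vector [a, b, c, d] :: 'a ^ 4) $ 3 = c" "(vector [a, b, c, d] :: 'a ^ 4) $ 4 = d"
  unfolding vector_def by simp_all

lemma inner_vector_4:
  fixes a b c d a' b' c' d' a'' b'' c'' d'' :: real
  shows "((vector [a, b, c, d] :: real ^ 4) - vector [a', b', c', d']) \<bullet> vector [a'', b'', c'', d'']
    = (a - a') * a'' + (b - b') * b'' + (c - c') * c'' + (d - d') * d''"
  by (simp add: inner_vec_def sum_4 vector_4)

text \<open>Both fluxes have the shape below, with mass flux \<open>m\<close> and pressure terms \<open>P\<close> and \<open>Q\<close>.\<close>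

lemma entropy_vars_jump_inner:
  fixes m P Q :: real
  assumes "\<gamma> > 1" "admissible \<gamma> um" "admissible \<gamma> up"
  defines "fx \<equiv> momentum_factor \<gamma> vel_x um up * m + P"
    and "fy \<equiv> momentum_factor \<gamma> vel_y um up * m + Q"
    and "B \<equiv> arith_mean (\<lambda>u. 1 / RT \<gamma> u) um up"
  shows "(entropy_vars \<gamma> up - entropy_vars \<gamma> um) \<bullet> vector [m, fx, fy,
      energy_factor \<gamma> um up * m + arith_mean vel_x um up * fx + arith_mean vel_y um up * fy]
    = (ln (density up) - ln (density um)) * m
      + B * (vel_x up - vel_x um) * P + B * (vel_y up - vel_y um) * Q"
proof -
  define b where "b = 1 / RT \<gamma> up - 1 / RT \<gamma> um"
  define lnT where "lnT = (ln (RT \<gamma> up) - ln (RT \<gamma> um)) / (\<gamma> - 1)"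
  define kx where "kx = ((vel_x up)\<^sup>2 / RT \<gamma> up - (vel_x um)\<^sup>2 / RT \<gamma> um) / 2"
  define ky where "ky = ((vel_y up)\<^sup>2 / RT \<gamma> up - (vel_y um)\<^sup>2 / RT \<gamma> um) / 2"
  define wx where "wx = vel_x up / RT \<gamma> up - vel_x um / RT \<gamma> um"
  define wy where "wy = vel_y up / RT \<gamma> up - vel_y um / RT \<gamma> um"
  define X where "X = arith_mean vel_x um up"
  define Y where "Y = arith_mean vel_y um up"
  have w: "wx = B * (vel_x up - vel_x um) + b * X" "wy = B * (vel_y up - vel_y um) + b * Y"
    using weighted_velocity_jump[of vel_x up \<gamma> um] weighted_velocity_jump[of vel_y up \<gamma> um]
    by (simp_all add: B_def b_def wx_def wy_def X_def Y_def)
  have mx: "B * (vel_x up - vel_x um) * momentum_factor \<gamma> vel_x um up = kx - b * X\<^sup>2 / 2"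
    and my: "B * (vel_y up - vel_y um) * momentum_factor \<gamma> vel_y um up = ky - b * Y\<^sup>2 / 2"
    using momentum_factor_jump[OF assms(2,3)]
    by (simp_all only: B_def b_def kx_def ky_def X_def Y_def)
  have e: "b * energy_factor \<gamma> um up = - lnT - b * (X\<^sup>2 + Y\<^sup>2) / 2"
    using energy_factor_jump[OF assms(2,3)]
    by (simp only: b_def lnT_def X_def Y_def minus_divide_left)
  have fx: "B * (vel_x up - vel_x um) * fx
      = (kx - b * X\<^sup>2 / 2) * m + B * (vel_x up - vel_x um) * P"
    unfolding fx_def mx[symmetric] by (simp add: algebra_simps)
  have fy: "B * (vel_y up - vel_y um) * fy
      = (ky - b * Y\<^sup>2 / 2) * m + B * (vel_y up - vel_y um) * Q"
    unfolding fy_def my[symmetric] by (simp add: algebra_simps)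
  \<comment> \<open>The constant \<gamma> / (\<gamma> - 1) drops out of the jump, and the last
    entropy variable jumps by \<open>- b\<close>.\<close>
  have "(entropy_vars \<gamma> up - entropy_vars \<gamma> um) \<bullet> vector [m, fx, fy,
      energy_factor \<gamma> um up * m + X * fx + Y * fy]
    = (ln (density up) - ln (density um) - lnT - kx - ky) * m + wx * fx + wy * fy
      - b * (energy_factor \<gamma> um up * m + X * fx + Y * fy)"
    unfolding entropy_vars_eq[OF assms(1,2)] entropy_vars_eq[OF assms(1,3)] inner_vector_4
      b_def lnT_def kx_def ky_def wx_def wy_def
    by (simp add: diff_divide_distrib algebra_simps)
  \<comment> \<open>The parts \<open>b * X\<close> of \<open>wx\<close> and \<open>b * Y\<close> of
    \<open>wy\<close> cancel the velocity terms of the energy flux.\<close>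
  also have "\<dots> = (ln (density up) - ln (density um) - lnT - kx - ky) * m
      + B * (vel_x up - vel_x um) * fx + B * (vel_y up - vel_y um) * fy
      - (b * energy_factor \<gamma> um up) * m"
    unfolding w by (simp add: algebra_simps)
  \<comment> \<open>Now \<open>lnT\<close>, \<open>kx\<close>, \<open>ky\<close> and the terms in
    \<open>b * X\<^sup>2\<close> and \<open>b * Y\<^sup>2\<close> cancel in pairs.\<close>
  also have "\<dots> = (ln (density up) - ln (density um)) * m
      + B * (vel_x up - vel_x um) * P + B * (vel_y up - vel_y um) * Q"
    unfolding fx fy e by (simp add: algebra_simps add_divide_distrib)
  finally show ?thesis
    by (simp only: X_def Y_def)
qed

text \<open>The logarithmic mean turns [ln rho] into [rho] and \<open>B\<close> cancels, so the
  claim becomes the product rule [rho] {{v}} + {{rho}} [v] = [rho v].\<close>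

lemma density_velocity_jump:
  assumes "admissible \<gamma> um" "admissible \<gamma> up"
  defines "B \<equiv> arith_mean (\<lambda>u. 1 / RT \<gamma> u) um up"
  shows "(ln (density up) - ln (density um)) * (log_mean density um up * arith_mean v um up)
      + B * (v up - v um) * (arith_mean density um up / B)
    = density up * v up - density um * v um"
proof -
  have "log_mean density um up * (ln (density up) - ln (density um)) = density up - density um"
    using assms(1,2) by (intro log_mean_times_ln_diff) (simp_all add: admissible_def)
  then have "(ln (density up) - ln (density um)) * (log_mean density um up * arith_mean v um up)
      = (density up - density um) * arith_mean v um up"
    by (metis mult.assoc mult.commute)
  moreover have "B * (v up - v um) * (arith_mean density um up / B)
      = (v up - v um) * arith_mean density um up"
    using arith_mean_inverse_RT_pos[OF assms(1,2)] by (simp add: B_def)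
  ultimately show ?thesis
    by (simp add: arith_mean_def field_simps)
qed

theorem mainTheorem7:
  fixes \<gamma> :: real
  assumes "\<gamma> > 1"
  shows "entropy_conservative \<gamma> flux_potential_x (euler_flux_x \<gamma>)
       \<and> entropy_conservative \<gamma> flux_potential_y (euler_flux_y \<gamma>)"
proof
  show "entropy_conservative \<gamma> flux_potential_x (euler_flux_x \<gamma>)"
    unfolding entropy_conservative_def
  proof (intro allI impI)
    fix um up assume adm: "admissible \<gamma> um" "admissible \<gamma> up"
    show "(entropy_vars \<gamma> up - entropy_vars \<gamma> um) \<bullet> euler_flux_x \<gamma> um up
        - (flux_potential_x up - flux_potential_x um) = 0"
      \<comment> \<open>The pressure enters only the x-momentum flux, so \<open>Q\<close> vanishes
        and \<open>P\<close> is {{rho}} / {{1/RT}}; in the y-direction the roles are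
        exchanged.\<close>
      using entropy_vars_jump_inner[OF assms adm, where Q = 0]
        density_velocity_jump[OF adm, of vel_x]
      by (simp only: euler_flux_x_def flux_potential_x_def Let_def add_0_right mult_zero_right
          diff_self)
  qed
  show "entropy_conservative \<gamma> flux_potential_y (euler_flux_y \<gamma>)"
    unfolding entropy_conservative_def
  proof (intro allI impI)
    fix um up assume adm: "admissible \<gamma> um" "admissible \<gamma> up"
    show "(entropy_vars \<gamma> up - entropy_vars \<gamma> um) \<bullet> euler_flux_y \<gamma> um up
        - (flux_potential_y up - flux_potential_y um) = 0"
      using entropy_vars_jump_inner[OF assms adm, where P = 0]
        density_velocity_jump[OF adm, of vel_y]
      by (simp only: euler_flux_y_def flux_potential_y_def Let_def add_0_right mult_zero_right
          diff_self)
  qed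
qed

end
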